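(* Let $S$ be a commutative semiring such that $Q(S) + Q(S) \subseteq Q(S)$ (i.e. the sum of two squares in $S$ is a square in $S$), let $n \ge 1$, and let $M \in \mathcal{M}_n(S)$. The following statements are equivalent. (1) $M$ is a symmetric strongly invertible matrix with a nonnegative numerical range. (2) $M = LL^T$ for some strongly invertible lower triangular matrix $L \in \mathcal{M}_n(S)$. (3) $M$ is a symmetric strongly invertible positive semidefinite matrix.
   Context: A semiring is a set $S$ with operations $+$ and $\cdot$ such that $(S,+)$ is a commutative monoid with identity $0$, $(S,\cdot)$ is a monoid with identity $1$, multiplication distributes over addition on both sides, and $0\cdot a = a \cdot 0 = 0$ for all $a \in S$. It is commutative if $ab = ba$ for all $a,b \in S$. $\mathcal{M}_n(S)$ denotes the semiring of $n \times n$ matrices over $S$ with the usual matrix addition and multiplication, $I$ is the identity matrix, and $M^T$ is the transpose of $M$. A matrix $A\in\mathcal{M}_k(S)$ is invertible if there is $B \in \mathcal{M}_k(S)$ with $AB = BA = I$. A matrix $A \in \mathcal{M}_n(S)$ is strongly invertible if all of its leading principal submatrices (the upper-left $k \times k$ blocks, $1 \le k \le n$) are invertible. Let $Q(S) = \{a \in S : a = b^2 \text{ for some } b \in S\}$. A matrix $M \in \mathcal{M}_n(S)$ has a nonnegative numerical range if $x^T M x \in Q(S)$ for all column vectors $x \in S^n$. A symmetric matrix $M \in \mathcal{M}_n(S)$ is positive semidefinite if there exists a matrix $B$ over $S$ (of size $n \times m$ for some $m$) such that $M = BB^T$. *)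

theory Defs
  imports "Jordan_Normal_Form.Matrix"
begin

text \<open>
  A commutative semiring is a type of sort \<open>{comm_semiring_0, comm_monoid_mult}\<close>. The class
  \<open>comm_semiring_1\<close> would in addition impose \<open>0 \<noteq> 1\<close> and so exclude the trivial semiring.
\<close>

definition squares :: "'a :: monoid_mult set" where
  "squares = {a. \<exists>b. a = b\<^sup>2}"

text \<open>
  This is \<open>invertible_mat\<close> without the class constraint \<open>semiring_1\<close> (hence without \<open>0 \<noteq> 1\<close>).
\<close>

definition invertible_matrix :: "'a :: {semiring_0, monoid_mult} mat \<Rightarrow> bool" where
  "invertible_matrix A \<longleftrightarrow> square_mat A \<and>
     (\<exists>B \<in> carrier_mat (dim_row A) (dim_row A).
        A * B = 1\<^sub>m (dim_row A) \<and> B * A = 1\<^sub>m (dim_row A))"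

definition leading_principal_submatrix :: "nat \<Rightarrow> 'a mat \<Rightarrow> 'a mat" where
  "leading_principal_submatrix k A = mat k k (\<lambda>(i, j). A $$ (i, j))"

definition strongly_invertible :: "'a :: {semiring_0, monoid_mult} mat \<Rightarrow> bool" where
  "strongly_invertible A \<longleftrightarrow> square_mat A \<and>
     (\<forall>k \<in> {1..dim_row A}. invertible_matrix (leading_principal_submatrix k A))"

definition symmetric_matrix :: "'a mat \<Rightarrow> bool" where
  "symmetric_matrix A \<longleftrightarrow> transpose_mat A = A"

definition lower_triangular :: "'a :: zero mat \<Rightarrow> bool" where
  "lower_triangular A \<longleftrightarrow> (\<forall>i < dim_row A. \<forall>j < dim_col A. i < j \<longrightarrow> A $$ (i, j) = 0)"

definition nonneg_numerical_range :: "'a :: {semiring_0, monoid_mult} mat \<Rightarrow> bool" where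
  "nonneg_numerical_range A \<longleftrightarrow> square_mat A \<and>
     (\<forall>x \<in> carrier_vec (dim_row A). x \<bullet> (A *\<^sub>v x) \<in> squares)"

definition positive_semidefinite :: "'a :: semiring_0 mat \<Rightarrow> bool" where
  "positive_semidefinite A \<longleftrightarrow> symmetric_matrix A \<and>
     (\<exists>m. \<exists>B \<in> carrier_mat (dim_row A) m. A = B * transpose_mat B)"

end

theory Submission
  imports Defs
begin

text \<open>
  Over a field the implication from (1) to (2) is the Cholesky algorithm: split off the last row
  and column, \<open>M = (A, b; b\<^sup>T, D)\<close>, decompose \<open>A = L L\<^sup>T\<close> by induction, and extend \<open>L\<close> by the row
  \<open>((L\<inverse> b)\<^sup>T, e)\<close>, where \<open>e\<close> is a square root of the Schur complement \<open>D - b\<^sup>T A\<inverse> b\<close>.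
  A semiring has no subtraction, so the point to settle is that this complement exists. It does:
  when \<open>A\<close> and \<open>M\<close> are both invertible, the block equations \<open>M M\<inverse> = I = M\<inverse> M\<close> force \<open>b\<close> to have
  an additive inverse \<open>b'\<close>, and \<open>s = D + b\<^sup>T A\<inverse> b'\<close> is then inverse to the lower right block of
  \<open>M\<inverse>\<close> (\<open>schur_complement\<close>).

  The numerical range supplies the square root. The quadratic form of \<open>M\<close> takes the value \<open>s\<close> at
  the vector \<open>(A\<inverse> b', 1)\<close>, so \<open>s = e\<^sup>2\<close> (\<open>four_block_mat_congruence\<close>), and \<open>e\<close> is a unit since
  \<open>s\<close> is. The extended factor is invertible because \<open>b'\<close> provides the negative entries
  that block back substitution asks for (\<open>cholesky_step\<close>).

  The other implications are direct. Leading blocks of \<open>L L\<^sup>T\<close> are products of the leading blocks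
  of \<open>L\<close> when \<open>L\<close> is lower triangular, so (2) gives (3) with \<open>B = L\<close>. If \<open>M = B B\<^sup>T\<close>, then
  \<open>x\<^sup>T M x\<close> is the sum of the squares of the entries of \<open>B\<^sup>T x\<close>,
  which is a square because the squares are closed under addition, and (3) gives (1).
\<close>

section \<open>Matrix algebra over a semiring that may be trivial\<close>

text \<open>
  The class \<open>semiring_1\<close> includes \<open>0 \<noteq> 1\<close>; these unit laws hold in the trivial semiring as well.
\<close>

lemma mat_mult_one:
  fixes A :: "'a :: {semiring_0, monoid_mult} mat"
  shows "dim_row A = n \<Longrightarrow> 1\<^sub>m n * A = A" "dim_col A = n \<Longrightarrow> A * 1\<^sub>m n = A"
proof -
  have "(\<Sum>k = 0..<m. (if i = k then 1 else 0) * f k) = f i"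
    "(\<Sum>k = 0..<m. f k * (if k = i then 1 else 0)) = f i"
    if "i < m" for i m :: nat and f :: "nat \<Rightarrow> 'a"
    using that by (simp_all add: if_distrib if_distribR cong: if_cong)
  then show "dim_row A = n \<Longrightarrow> 1\<^sub>m n * A = A" "dim_col A = n \<Longrightarrow> A * 1\<^sub>m n = A"
    by (auto intro!: eq_matI simp: scalar_prod_def)
qed

text \<open>
  The next lemmas restate matrix arithmetic with equations between dimensions in place of carrier
  sets. The simplifier computes dimensions of compound terms, whereas a carrier premise would leave
  the inner dimension of a product undetermined; thus these equations serve as rewrite rules that
  normalise block computations.
\<close>

lemma mat_dim_algebra:
  fixes A :: "'a :: semiring_0 mat"
  shows "dim_col A = dim_row B \<Longrightarrow> dim_col B = dim_row C \<Longrightarrow> A * B * C = A * (B * C)"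
    and "dim_row A = dim_row B \<Longrightarrow> dim_col A = dim_col B \<Longrightarrow> dim_col B = dim_row C
      \<Longrightarrow> (A + B) * C = A * C + B * C"
    and "dim_row B = dim_row C \<Longrightarrow> dim_col B = dim_col C \<Longrightarrow> dim_col A = dim_row C
      \<Longrightarrow> A * (B + C) = A * B + A * C"
  by (metis assoc_mult_mat carrier_matI, metis add_mult_distrib_mat carrier_matI,
      metis mult_add_distrib_mat carrier_matI)

lemma mat_dim_add_ac:
  fixes A :: "'a :: comm_monoid_add mat"
  shows "dim_row A = dim_row B \<Longrightarrow> dim_col A = dim_col B \<Longrightarrow> A + B = B + A"
    and "dim_row A = dim_row B \<Longrightarrow> dim_col A = dim_col B \<Longrightarrow> dim_row B = dim_row C
      \<Longrightarrow> dim_col B = dim_col C \<Longrightarrow> A + B + C = A + (B + C)"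
    and "dim_row A = dim_row B \<Longrightarrow> dim_col A = dim_col B \<Longrightarrow> dim_row B = dim_row C
      \<Longrightarrow> dim_col B = dim_col C \<Longrightarrow> A + (B + C) = B + (A + C)"
  by (auto intro!: eq_matI simp: ac_simps)

lemma mat_dim_zero:
  fixes A :: "'a :: monoid_add mat"
  shows "dim_row A = n \<Longrightarrow> dim_col A = m \<Longrightarrow> A + 0\<^sub>m n m = A"
    and "dim_row A = n \<Longrightarrow> dim_col A = m \<Longrightarrow> 0\<^sub>m n m + A = A"
  by (auto intro!: eq_matI)

lemma mat_dim_transpose_mult:
  fixes A :: "'a :: comm_semiring_0 mat"
  shows "dim_col A = dim_row B \<Longrightarrow> transpose_mat (A * B) = transpose_mat B * transpose_mat A"
  by (metis transpose_mult carrier_matI)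

lemma four_block_mat_inject:
  assumes "four_block_mat A B C D = four_block_mat A' B' C' D'"
    and "A \<in> carrier_mat n m" "B \<in> carrier_mat n k" "C \<in> carrier_mat l m" "D \<in> carrier_mat l k"
    and "A' \<in> carrier_mat n m" "B' \<in> carrier_mat n k" "C' \<in> carrier_mat l m" "D' \<in> carrier_mat l k"
  shows "A = A'" "B = B'" "C = C'" "D = D'"
proof -
  have E: "four_block_mat A B C D $$ (i, j) = four_block_mat A' B' C' D' $$ (i, j)" for i j
    using assms(1) by simp
  show "A = A'"
  proof (rule eq_matI)
    fix i j assume "i < dim_row A'" "j < dim_col A'"
    then show "A $$ (i, j) = A' $$ (i, j)" using E[of i j] assms(2-) by auto
  qed (use assms(2-) in auto)
  show "B = B'"
  proof (rule eq_matI)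
    fix i j assume "i < dim_row B'" "j < dim_col B'"
    then show "B $$ (i, j) = B' $$ (i, j)" using E[of i "j + m"] assms(2-) by auto
  qed (use assms(2-) in auto)
  show "C = C'"
  proof (rule eq_matI)
    fix i j assume "i < dim_row C'" "j < dim_col C'"
    then show "C $$ (i, j) = C' $$ (i, j)" using E[of "i + n" j] assms(2-) by auto
  qed (use assms(2-) in auto)
  show "D = D'"
  proof (rule eq_matI)
    fix i j assume "i < dim_row D'" "j < dim_col D'"
    then show "D $$ (i, j) = D' $$ (i, j)" using E[of "i + n" "j + m"] assms(2-) by auto
  qed (use assms(2-) in auto)
qed

lemma four_block_mat_cases:
  assumes "M \<in> carrier_mat (n + m) (n + m)"
  obtains A B C D where "M = four_block_mat A B C D"
    "A \<in> carrier_mat n n" "B \<in> carrier_mat n m" "C \<in> carrier_mat m n" "D \<in> carrier_mat m m"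
proof -
  obtain A B C D where "split_block M n n = (A, B, C, D)" by (metis prod_cases4)
  from split_block[OF this, of m m] assms that show ?thesis by auto
qed

lemma invertible_matrixE:
  assumes "invertible_matrix A" "A \<in> carrier_mat n n"
  obtains B where "B \<in> carrier_mat n n" "A * B = 1\<^sub>m n" "B * A = 1\<^sub>m n"
  using assms by (auto simp: invertible_matrix_def)

lemma invertible_matrixI:
  "A \<in> carrier_mat n n \<Longrightarrow> B \<in> carrier_mat n n \<Longrightarrow> A * B = 1\<^sub>m n \<Longrightarrow> B * A = 1\<^sub>m n
    \<Longrightarrow> invertible_matrix A"
  by (auto simp: invertible_matrix_def)

section \<open>The Schur complement\<close>

text \<open>
  Write the inverse of the block matrix as \<open>(P, q; q', r)\<close>. Then \<open>A q + b r = 0\<close> and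
  \<open>q' A + r c = 0\<close>; so \<open>b r\<close> has the additive inverse \<open>A q\<close>, and \<open>q' = q' A A'\<close> has the additive
  inverse \<open>r c A'\<close>. Since \<open>q' b + r D = 1\<close>, the block \<open>b = b (q' b + r D) = b q' b + (b r) D\<close> is a sum
  of two terms with additive inverses. With \<open>b'\<close> in the place of \<open>- b\<close>, the matrix
  \<open>D + c A' b'\<close> is the Schur complement \<open>D - c A' b\<close>, and its inverse is \<open>r\<close>, as over a ring.
\<close>

lemma schur_complement:
  fixes A b c D :: "'a :: {semiring_0, monoid_mult} mat"
  assumes A: "A \<in> carrier_mat n n" and b: "b \<in> carrier_mat n m"
    and c: "c \<in> carrier_mat m n" and D: "D \<in> carrier_mat m m"
    and A': "A' \<in> carrier_mat n n" and AA': "A * A' = 1\<^sub>m n" and A'A: "A' * A = 1\<^sub>m n"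
    and inv: "invertible_matrix (four_block_mat A b c D)"
  obtains b' r where "b' \<in> carrier_mat n m" "r \<in> carrier_mat m m" "b + b' = 0\<^sub>m n m"
    "(D + c * (A' * b')) * r = 1\<^sub>m m" "r * (D + c * (A' * b')) = 1\<^sub>m m"
proof -
  obtain N where N: "N \<in> carrier_mat (n + m) (n + m)"
    and MN: "four_block_mat A b c D * N = 1\<^sub>m (n + m)"
    and NM: "N * four_block_mat A b c D = 1\<^sub>m (n + m)"
    using invertible_matrixE[OF inv] A D by (metis four_block_carrier_mat)
  obtain P q q' r where Neq: "N = four_block_mat P q q' r"
    and P: "P \<in> carrier_mat n n" and q: "q \<in> carrier_mat n m"
    and q': "q' \<in> carrier_mat m n" and r: "r \<in> carrier_mat m m"
    using four_block_mat_cases[OF N] .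
  note cs = A b c D A' P q q' r
  note dims = cs[THEN carrier_matD(1)] cs[THEN carrier_matD(2)]
  note alg = dims mat_dim_algebra mat_mult_one mat_dim_zero
  have "four_block_mat (A * P + b * q') (A * q + b * r) (c * P + D * q') (c * q + D * r)
      = four_block_mat (1\<^sub>m n) (0\<^sub>m n m) (0\<^sub>m m n) (1\<^sub>m m)"
    using MN unfolding Neq by (simp add: mult_four_block_mat[OF A b c D P q q' r])
  note MN' = four_block_mat_inject[OF this, of n n m m]
  have 1: "A * q + b * r = 0\<^sub>m n m" and 2: "c * q + D * r = 1\<^sub>m m"
    using MN'(2,4) cs by auto
  have "four_block_mat (P * A + q * c) (P * b + q * D) (q' * A + r * c) (q' * b + r * D)
      = four_block_mat (1\<^sub>m n) (0\<^sub>m n m) (0\<^sub>m m n) (1\<^sub>m m)"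
    using NM unfolding Neq by (simp add: mult_four_block_mat[OF P q q' r A b c D])
  note NM' = four_block_mat_inject[OF this, of n n m m]
  have 3: "q' * A + r * c = 0\<^sub>m m n" and 4: "q' * b + r * D = 1\<^sub>m m"
    using NM'(3,4) cs by auto
  have "q' + r * (c * A') = (q' * A + r * c) * A'" by (simp add: alg AA')
  then have 5: "q' + r * (c * A') = 0\<^sub>m m n" by (simp add: 3 dims)
  \<comment> \<open>The negatives of \<open>b q' b\<close> and of \<open>(b r) D\<close>, by the equations \<open>q' + r c A' = 0\<close> and
    \<open>A q + b r = 0\<close>.\<close>
  define b' where "b' = b * (r * (c * (A' * b))) + A * (q * D)"
  have b': "b' \<in> carrier_mat n m" unfolding b'_def using cs by auto
  have "b = b * (q' * b + r * D)" by (simp add: 4 alg)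
  then have "b + b' = b * (q' * b + r * D) + b'" by simp
  also have "\<dots> = b * ((q' + r * (c * A')) * b) + (A * q + b * r) * D"
    unfolding b'_def by (simp add: alg mat_dim_add_ac)
  also have "\<dots> = 0\<^sub>m n m" by (simp add: 1 5 dims mat_dim_zero)
  finally have bb': "b + b' = 0\<^sub>m n m" .
  note dims' = dims carrier_matD[OF b']
  note alg = dims' mat_dim_algebra mat_mult_one mat_dim_zero
  have "b' * r = A * q + (b + b') * r"
  proof -
    have "b' * r = (A * q + b * r) + b' * r" by (simp add: 1 alg)
    also have "\<dots> = A * q + (b + b') * r" by (simp add: alg mat_dim_add_ac)
    finally show ?thesis .
  qed
  then have "b' * r = A * q" by (simp add: bb' alg)
  moreover have "A' * (A * q) = A' * A * q" by (simp add: alg)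
  ultimately have "A' * (b' * r) = q" by (simp add: A'A alg)
  then have sr: "(D + c * (A' * b')) * r = 1\<^sub>m m"
    using 2 by (simp add: alg mat_dim_add_ac)
  have "r * (D + c * (A' * b')) = r * D + q' * (b + b') + r * (c * (A' * b'))"
    by (simp add: bb' alg)
  also have "\<dots> = (q' * b + r * D) + (q' + r * (c * A')) * b'"
    by (simp add: alg mat_dim_add_ac)
  also have "\<dots> = 1\<^sub>m m" by (simp add: 4 5 alg)
  finally show ?thesis using that b' r bb' sr by blast
qed

section \<open>Leading principal submatrices\<close>

lemma leading_principal_submatrix_carrier [simp]:
  "leading_principal_submatrix k A \<in> carrier_mat k k"
  by (simp add: leading_principal_submatrix_def)

lemma leading_principal_submatrix_self:
  "A \<in> carrier_mat k k \<Longrightarrow> leading_principal_submatrix k A = A"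
  by (auto simp: leading_principal_submatrix_def)

text \<open>
  This is the recursion on which the induction rests: bordering by one row and one column leaves the
  old leading blocks in place and adds the whole matrix as a new one.
\<close>

lemma strongly_invertible_four_block_mat:
  assumes A: "A \<in> carrier_mat n n" and D: "D \<in> carrier_mat 1 1"
  shows "strongly_invertible (four_block_mat A B C D)
    \<longleftrightarrow> strongly_invertible A \<and> invertible_matrix (four_block_mat A B C D)"
proof -
  let ?M = "four_block_mat A B C D"
  have M: "?M \<in> carrier_mat (Suc n) (Suc n)" using four_block_carrier_mat[OF A D] by simp
  have "leading_principal_submatrix k ?M = leading_principal_submatrix k A" if "k \<le> n" for k
    using A D that by (auto simp: leading_principal_submatrix_def)
  moreover have "{1..Suc n} = insert (Suc n) {1..n}" by auto
  moreover have "dim_row ?M = Suc n" "square_mat ?M" using carrier_matD[OF M] by simp_all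
  moreover have "dim_row A = n" "square_mat A" using A by simp_all
  ultimately show ?thesis
    unfolding strongly_invertible_def
    by (simp add: leading_principal_submatrix_self[OF M] conj_commute
        del: index_mat_four_block square_mat.simps)
qed

text \<open>
  The entry \<open>(i, j)\<close> of \<open>L L\<^sup>T\<close> pairs rows \<open>i\<close> and \<open>j\<close> of \<open>L\<close>; for \<open>i < k\<close> the row \<open>i\<close> of a lower
  triangular matrix vanishes from column \<open>k\<close> on.
\<close>

lemma leading_principal_submatrix_mult_transpose:
  fixes L :: "'a :: semiring_0 mat"
  assumes L: "L \<in> carrier_mat n n" and low: "lower_triangular L" and k: "k \<le> n"
  shows "leading_principal_submatrix k (L * transpose_mat L)
    = leading_principal_submatrix k L * transpose_mat (leading_principal_submatrix k L)"
proof (rule eq_matI)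
  fix i j
  assume "i < dim_row (leading_principal_submatrix k L * transpose_mat (leading_principal_submatrix k L))"
    "j < dim_col (leading_principal_submatrix k L * transpose_mat (leading_principal_submatrix k L))"
  then have ij: "i < k" "j < k" by (auto simp: leading_principal_submatrix_def)
  have "(\<Sum>l = 0..<n. L $$ (i, l) * L $$ (j, l)) = (\<Sum>l = 0..<k. L $$ (i, l) * L $$ (j, l))"
    using L low k ij
    by (intro sum.mono_neutral_right) (auto simp: lower_triangular_def)
  then show "leading_principal_submatrix k (L * transpose_mat L) $$ (i, j)
    = (leading_principal_submatrix k L * transpose_mat (leading_principal_submatrix k L)) $$ (i, j)"
    using ij k L by (simp add: leading_principal_submatrix_def scalar_prod_def)
qed (auto simp: leading_principal_submatrix_def)

lemma invertible_matrix_mult_transpose: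
  fixes A :: "'a :: {comm_semiring_0, comm_monoid_mult} mat"
  assumes "invertible_matrix A" "A \<in> carrier_mat n n"
  shows "invertible_matrix (A * transpose_mat A)"
proof -
  obtain B where B: "B \<in> carrier_mat n n" "A * B = 1\<^sub>m n" "B * A = 1\<^sub>m n"
    using invertible_matrixE[OF assms] .
  note alg = assms(2)[THEN carrier_matD(1)] assms(2)[THEN carrier_matD(2)] carrier_matD[OF B(1)]
    mat_dim_algebra mat_mult_one
  have T: "transpose_mat A * transpose_mat B = 1\<^sub>m n" "transpose_mat B * transpose_mat A = 1\<^sub>m n"
    using B alg by (simp_all flip: mat_dim_transpose_mult)
  have "A * transpose_mat A * (transpose_mat B * B) = A * (transpose_mat A * transpose_mat B) * B"
    "transpose_mat B * B * (A * transpose_mat A) = transpose_mat B * (B * A) * transpose_mat A"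
    by (simp_all add: alg)
  then show ?thesis
    using assms(2) B T by (intro invertible_matrixI[where B = "transpose_mat B * B" and n = n])
      (simp_all add: alg)
qed

lemma strongly_invertible_mult_transpose:
  fixes L :: "'a :: {comm_semiring_0, comm_monoid_mult} mat"
  assumes L: "L \<in> carrier_mat n n" and low: "lower_triangular L" and inv: "strongly_invertible L"
  shows "strongly_invertible (L * transpose_mat L)"
proof -
  have "invertible_matrix (leading_principal_submatrix k (L * transpose_mat L))"
    if "k \<in> {1..n}" for k
    using that L inv leading_principal_submatrix_mult_transpose[OF L low, of k]
      invertible_matrix_mult_transpose[OF _ leading_principal_submatrix_carrier, of k L]
    by (simp add: strongly_invertible_def)
  then show ?thesis using L by (simp add: strongly_invertible_def)
qed

section \<open>Sums of squares and the numerical range\<close>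

lemma scalar_prod_self_in_squares:
  fixes v :: "'a :: {comm_semiring_0, comm_monoid_mult} vec"
  assumes "\<forall>a \<in> (squares :: 'a set). \<forall>b \<in> (squares :: 'a set). a + b \<in> squares"
  shows "v \<bullet> v \<in> squares"
proof -
  have "(0 :: 'a) = 0\<^sup>2" by (simp add: power2_eq_square)
  then have zero: "(0 :: 'a) \<in> squares" unfolding squares_def by blast
  have sq: "x * x \<in> squares" for x :: 'a
    by (auto simp: squares_def power2_eq_square)
  have "(\<Sum>i\<in>I. v $ i * v $ i) \<in> squares" if "finite I" for I
    using that by (induction I rule: finite_induct) (use assms zero sq in auto)
  then show ?thesis by (simp add: scalar_prod_def)
qed

text \<open>
  \<open>x\<^sup>T B B\<^sup>T x\<close> is the scalar product of \<open>B\<^sup>T x\<close> with itself.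
\<close>

lemma nonneg_numerical_range_mult_transpose:
  fixes B :: "'a :: {comm_semiring_0, comm_monoid_mult} mat"
  assumes sq: "\<forall>a \<in> (squares :: 'a set). \<forall>b \<in> (squares :: 'a set). a + b \<in> squares"
    and B: "B \<in> carrier_mat n m"
  shows "nonneg_numerical_range (B * transpose_mat B)"
proof -
  have "x \<bullet> (B * transpose_mat B *\<^sub>v x) = (transpose_mat B *\<^sub>v x) \<bullet> (transpose_mat B *\<^sub>v x)"
    if x: "x \<in> carrier_vec n" for x
    using transpose_vec_mult_scalar[OF B _ x, of "transpose_mat B *\<^sub>v x"] B x by simp
  then show ?thesis
    using B scalar_prod_self_in_squares[OF sq] by (auto simp: nonneg_numerical_range_def)
qed

text \<open>
  A diagonal entry of \<open>T\<^sup>T M T\<close> is the quadratic form of \<open>M\<close> at a column of \<open>T\<close>. This turns the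
  evaluation of the form at a block vector into a block matrix product.
\<close>

lemma congruence_diagonal_in_squares:
  fixes M :: "'a :: {comm_semiring_0, comm_monoid_mult} mat"
  assumes nn: "nonneg_numerical_range M" and M: "M \<in> carrier_mat n n" and T: "T \<in> carrier_mat n m"
    and j: "j < m"
  shows "(transpose_mat T * (M * T)) $$ (j, j) \<in> squares"
proof -
  have "(transpose_mat T * (M * T)) $$ (j, j) = col T j \<bullet> (M *\<^sub>v col T j)"
    using M T j by (simp add: col_mult2[OF M T j])
  then show ?thesis
    using nn M T j by (auto simp: nonneg_numerical_range_def)
qed

text \<open>
  The form of \<open>A\<close> is the form of the block matrix restricted to vectors padded with zeros.
\<close>

lemma nonneg_numerical_range_four_block_mat:
  fixes A :: "'a :: {comm_semiring_0, comm_monoid_mult} mat"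
  assumes nn: "nonneg_numerical_range (four_block_mat A B C D)"
    and A: "A \<in> carrier_mat n n" and B: "B \<in> carrier_mat n m"
    and C: "C \<in> carrier_mat m n" and D: "D \<in> carrier_mat m m"
  shows "nonneg_numerical_range A"
proof -
  have "x \<bullet> (A *\<^sub>v x) \<in> squares" if x: "x \<in> carrier_vec n" for x
  proof -
    have 0: "B *\<^sub>v 0\<^sub>v m = 0\<^sub>v n" "D *\<^sub>v 0\<^sub>v m = 0\<^sub>v m"
      using B D by (auto intro!: eq_vecI)
    have "(x @\<^sub>v 0\<^sub>v m) \<bullet> (four_block_mat A B C D *\<^sub>v (x @\<^sub>v 0\<^sub>v m)) = x \<bullet> (A *\<^sub>v x)"
      using A B C D x 0
      by (simp add: four_block_mat_mult_vec[OF A B C D x] scalar_prod_append[of _ n _ m]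
          scalar_prod_left_zero[of _ m])
    moreover have "x @\<^sub>v 0\<^sub>v m \<in> carrier_vec (n + m)" using x by simp
    ultimately show ?thesis
      using nn A D by (metis nonneg_numerical_range_def four_block_carrier_mat carrier_matD(1))
  qed
  then show ?thesis using A by (auto simp: nonneg_numerical_range_def)
qed

section \<open>The Cholesky decomposition\<close>

text \<open>
  Block elimination. The last columns of \<open>T\<close> are \<open>(A\<inverse> b', 1)\<close>, the semiring version of
  \<open>(- A\<inverse> b, 1)\<close>; they are chosen so that \<open>A (A\<inverse> b') + b = 0\<close>. Hence multiplying by \<open>T\<close> clears the
  upper right block and puts the Schur complement in the lower right corner. Multiplying
  by \<open>T\<^sup>T\<close> from the left keeps that corner, because only zeros are added to it, so the diagonal
  entries of the Schur complement are values of the quadratic form.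
\<close>

lemma four_block_mat_congruence:
  fixes A :: "'a :: {comm_semiring_0, comm_monoid_mult} mat"
  assumes A: "A \<in> carrier_mat n n" and b: "b \<in> carrier_mat n m"
    and c: "c \<in> carrier_mat m n" and D: "D \<in> carrier_mat m m"
    and A': "A' \<in> carrier_mat n n" and AA': "A * A' = 1\<^sub>m n"
    and b': "b' \<in> carrier_mat n m" and bb': "b + b' = 0\<^sub>m n m"
  defines "T \<equiv> four_block_mat (1\<^sub>m n) (A' * b') (0\<^sub>m m n) (1\<^sub>m m)"
  shows "\<exists>C. C \<in> carrier_mat m n \<and> transpose_mat T * (four_block_mat A b c D * T)
    = four_block_mat A (0\<^sub>m n m) C (D + c * (A' * b'))"
proof -
  note cs = A b c D A' b'
  note alg = cs[THEN carrier_matD(1)] cs[THEN carrier_matD(2)]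
    mat_dim_algebra mat_mult_one mat_dim_zero
  let ?K = "A' * b'"
  have K: "?K \<in> carrier_mat n m" using cs by simp
  have "A * ?K = A * A' * b'" by (simp add: alg)
  then have AK: "A * ?K + b = 0\<^sub>m n m" using bb' by (simp add: AA' alg mat_dim_add_ac)
  have "four_block_mat A b c D * T = four_block_mat A (0\<^sub>m n m) c (D + c * ?K)"
    unfolding T_def
    by (subst mult_four_block_mat[OF A b c D one_carrier_mat K zero_carrier_mat one_carrier_mat])
      (use AK in \<open>simp_all add: alg mat_dim_add_ac\<close>)
  moreover have "transpose_mat T = four_block_mat (1\<^sub>m n) (0\<^sub>m n m) (transpose_mat ?K) (1\<^sub>m m)"
    unfolding T_def
    by (subst transpose_four_block_mat[OF one_carrier_mat K zero_carrier_mat one_carrier_mat]) simp_all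
  ultimately have "transpose_mat T * (four_block_mat A b c D * T)
    = four_block_mat A (0\<^sub>m n m) (transpose_mat ?K * A + c) (D + c * ?K)"
    using cs by (simp add: mult_four_block_mat[of _ n n _ m _ m _ _ n _ m] alg)
  then show ?thesis using cs by (intro exI[of _ "transpose_mat ?K * A + c"]) simp
qed

text \<open>
  The new row block \<open>C = (L\<inverse> b)\<^sup>T\<close> is determined by \<open>L C\<^sup>T = b\<close>. Over a ring the inverse of
  \<open>F = (L, 0; C, E)\<close> is \<open>(L\<inverse>, 0; - E\<inverse> C L\<inverse>, E\<inverse>)\<close>; here \<open>(L\<inverse> b')\<^sup>T\<close> takes the place of \<open>- C\<close>.
\<close>

lemma cholesky_step:
  fixes L b D E :: "'a :: {comm_semiring_0, comm_monoid_mult} mat"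
  assumes L: "L \<in> carrier_mat n n" and L': "L' \<in> carrier_mat n n"
    and LL': "L * L' = 1\<^sub>m n" and L'L: "L' * L = 1\<^sub>m n"
    and E: "E \<in> carrier_mat m m" and E': "E' \<in> carrier_mat m m"
    and EE': "E * E' = 1\<^sub>m m" and E'E: "E' * E = 1\<^sub>m m"
    and b: "b \<in> carrier_mat n m" and b': "b' \<in> carrier_mat n m" and bb': "b + b' = 0\<^sub>m n m"
    and D: "D = E * transpose_mat E + transpose_mat (L' * b) * (L' * b)"
  defines "F \<equiv> four_block_mat L (0\<^sub>m n m) (transpose_mat (L' * b)) E"
  shows "invertible_matrix F"
    and "F * transpose_mat F = four_block_mat (L * transpose_mat L) b (transpose_mat b) D"
proof -
  note cs = L L' E E' b b'
  note alg = cs[THEN carrier_matD(1)] cs[THEN carrier_matD(2)]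
    mat_dim_algebra mat_mult_one mat_dim_zero
  let ?C = "transpose_mat (L' * b)" and ?C' = "transpose_mat (L' * b')"
  let ?Z = "0\<^sub>m n m :: 'a mat"
  have C: "?C \<in> carrier_mat m n" and C': "?C' \<in> carrier_mat m n" and Z: "?Z \<in> carrier_mat n m"
    using cs by simp_all
  have "?C + ?C' = transpose_mat (L' * (b + b'))"
    using cs by (simp add: mult_add_distrib_mat[OF L' b b'] transpose_add[of _ n m])
  then have CC': "?C + ?C' = 0\<^sub>m m n" by (simp add: bb' alg)
  note alg = alg carrier_matD[OF C] carrier_matD[OF C']
  let ?G = "E' * (?C' * L')"
  have G: "?G \<in> carrier_mat m n" using E' C' L' by (meson mult_carrier_mat)
  have "E * ?G = E * E' * (?C' * L')" by (simp add: alg)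
  then have "?C * L' + E * ?G = (?C + ?C') * L'" by (simp add: EE' alg)
  then have 1: "?C * L' + E * ?G = 0\<^sub>m m n" by (simp only: CC') (simp add: alg)
  have "?G * L + E' * ?C = E' * (?C' * (L' * L) + ?C)"
    by (simp add: alg del: transpose_mult)
  also have "\<dots> = E' * (?C + ?C')" by (simp add: L'L alg mat_dim_add_ac)
  finally have 2: "?G * L + E' * ?C = 0\<^sub>m m n" by (simp only: CC') (simp add: alg)
  have "F * four_block_mat L' ?Z ?G E' = 1\<^sub>m (n + m)" unfolding F_def
    by (subst mult_four_block_mat[OF L Z C E L' Z G E'])
      (use 1 LL' EE' in \<open>simp add: alg\<close>)
  moreover have "four_block_mat L' ?Z ?G E' * F = 1\<^sub>m (n + m)" unfolding F_def
    by (subst mult_four_block_mat[OF L' Z G E' L Z C E])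
      (use 2 L'L E'E in \<open>simp add: alg\<close>)
  ultimately show "invertible_matrix F"
    unfolding F_def using L L' E E'
    by (intro invertible_matrixI[where n = "n + m" and B = "four_block_mat L' ?Z ?G E'"]) simp_all
  have LC: "L * (L' * b) = b"
  proof -
    have "L * (L' * b) = L * L' * b" by (simp add: alg)
    then show ?thesis by (simp add: LL' alg)
  qed
  then have CL: "?C * transpose_mat L = transpose_mat b"
    using mat_dim_transpose_mult[of L "L' * b"] by (simp add: alg)
  have "transpose_mat F = four_block_mat (transpose_mat L) (L' * b) (0\<^sub>m m n) (transpose_mat E)"
    unfolding F_def by (simp add: transpose_four_block_mat[OF L Z C E])
  then show "F * transpose_mat F = four_block_mat (L * transpose_mat L) b (transpose_mat b) D"
    unfolding F_def using cs C LC CL D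
    by (simp add: mult_four_block_mat[of _ n n _ m _ m _ _ n _ m] alg mat_dim_add_ac)
qed

text \<open>
  If \<open>s = e\<^sup>2\<close> is a unit with inverse \<open>r\<close>, then \<open>e\<close> is a unit with inverse \<open>e r\<close>.
\<close>

lemma unit_square_1x1:
  fixes s r :: "'a :: {comm_semiring_0, comm_monoid_mult} mat"
  assumes "s \<in> carrier_mat 1 1" "r \<in> carrier_mat 1 1" "s * r = 1\<^sub>m 1" "s $$ (0, 0) \<in> squares"
  obtains E E' where "E \<in> carrier_mat 1 1" "E' \<in> carrier_mat 1 1" "s = E * transpose_mat E"
    "E * E' = 1\<^sub>m 1" "E' * E = 1\<^sub>m 1"
proof -
  obtain e where e: "s $$ (0, 0) = e * e"
    using assms(4) by (auto simp: squares_def power2_eq_square)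
  have "(s * r) $$ (0, 0) = s $$ (0, 0) * r $$ (0, 0)"
    using assms(1,2) by (simp add: scalar_prod_def)
  then have 1: "e * (e * r $$ (0, 0)) = 1" using assms(3) e by (simp add: ac_simps)
  show ?thesis
    by (rule that[of "mat 1 1 (\<lambda>_. e)" "mat 1 1 (\<lambda>_. e * r $$ (0, 0))"])
      (use assms(1) e 1 in \<open>auto intro!: eq_matI simp: scalar_prod_def ac_simps\<close>)
qed

text \<open>
  Invertibility of \<open>L\<close> itself is part of the conclusion so that the induction can start at \<open>n = 0\<close>,
  where a strongly invertible matrix has no leading blocks and the condition is vacuous.
\<close>

lemma cholesky_exists:
  fixes M :: "'a :: {comm_semiring_0, comm_monoid_mult} mat"
  assumes "M \<in> carrier_mat n n" "symmetric_matrix M" "strongly_invertible M"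
    "nonneg_numerical_range M"
  shows "\<exists>L \<in> carrier_mat n n. invertible_matrix L \<and> strongly_invertible L \<and> lower_triangular L
    \<and> M = L * transpose_mat L"
  using assms
proof (induction n arbitrary: M)
  case 0
  have "invertible_matrix (1\<^sub>m 0 :: 'a mat)"
    by (rule invertible_matrixI[of _ 0 "1\<^sub>m 0"]) (simp_all add: mat_mult_one)
  with 0 show ?case
    by (intro bexI[of _ "1\<^sub>m 0"])
      (auto simp: strongly_invertible_def lower_triangular_def)
next
  case (Suc n)
  obtain A b c D where Meq: "M = four_block_mat A b c D"
    and A: "A \<in> carrier_mat n n" and b: "b \<in> carrier_mat n 1"
    and c: "c \<in> carrier_mat 1 n" and D: "D \<in> carrier_mat 1 1"
    using four_block_mat_cases[of M n 1] Suc.prems(1) by (metis Suc_eq_plus1)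
  have "four_block_mat (transpose_mat A) (transpose_mat c) (transpose_mat b) (transpose_mat D)
      = four_block_mat A b c D"
    using Suc.prems(2) transpose_four_block_mat[OF A b c D]
    by (simp add: Meq symmetric_matrix_def)
  from four_block_mat_inject[OF this, of n n 1 1]
  have symA: "symmetric_matrix A" and cb: "c = transpose_mat b"
    using A b c D by (auto simp: symmetric_matrix_def)
  have sA: "strongly_invertible A" and iM: "invertible_matrix (four_block_mat A b c D)"
    using Suc.prems(3) strongly_invertible_four_block_mat[OF A D] by (auto simp: Meq)
  have nA: "nonneg_numerical_range A"
    using nonneg_numerical_range_four_block_mat[OF _ A b c D] Suc.prems(4) by (simp add: Meq)
  obtain L where L: "L \<in> carrier_mat n n" and iL: "invertible_matrix L"
    and sL: "strongly_invertible L" and lL: "lower_triangular L" and AL: "A = L * transpose_mat L"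
    using Suc.IH[OF A symA sA nA] by blast
  obtain L' where L': "L' \<in> carrier_mat n n" and LL': "L * L' = 1\<^sub>m n" and L'L: "L' * L = 1\<^sub>m n"
    using invertible_matrixE[OF iL L] .
  \<comment> \<open>The inverse of \<open>A = L L\<^sup>T\<close> in factored form, so that \<open>b\<^sup>T A\<inverse> b\<close> becomes \<open>(L\<inverse> b)\<^sup>T (L\<inverse> b)\<close> below.\<close>
  let ?A' = "transpose_mat L' * L'"
  note alg = carrier_matD[OF L] carrier_matD[OF L'] carrier_matD[OF b] carrier_matD[OF D]
    mat_dim_algebra mat_mult_one mat_dim_zero
  have A': "?A' \<in> carrier_mat n n" using L' by simp
  have "transpose_mat L * transpose_mat L' = 1\<^sub>m n"
    using L'L alg by (simp flip: mat_dim_transpose_mult)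
  moreover have "A * ?A' = L * (transpose_mat L * transpose_mat L') * L'" by (simp add: AL alg)
  ultimately have AA': "A * ?A' = 1\<^sub>m n" by (simp add: LL' alg)
  have "transpose_mat L' * transpose_mat L = 1\<^sub>m n"
    using LL' alg by (simp flip: mat_dim_transpose_mult)
  moreover have "?A' * A = transpose_mat L' * (L' * L) * transpose_mat L" by (simp add: AL alg)
  ultimately have A'A: "?A' * A = 1\<^sub>m n" by (simp add: L'L alg)
  obtain b' r where b': "b' \<in> carrier_mat n 1" and r: "r \<in> carrier_mat 1 1"
    and bb': "b + b' = 0\<^sub>m n 1" and sr: "(D + c * (?A' * b')) * r = 1\<^sub>m 1"
    using schur_complement[OF A b c D A' AA' A'A iM] by blast
  define s where "s = D + c * (?A' * b')"
  have s: "s \<in> carrier_mat 1 1" unfolding s_def using D c A' b' by simp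
  define T where "T = four_block_mat (1\<^sub>m n) (?A' * b') (0\<^sub>m 1 n) (1\<^sub>m 1)"
  have T: "T \<in> carrier_mat (n + 1) (n + 1)"
    unfolding T_def by (rule four_block_carrier_mat) simp_all
  obtain C where C: "C \<in> carrier_mat 1 n"
    and TMT: "transpose_mat T * (M * T) = four_block_mat A (0\<^sub>m n 1) C s"
    using four_block_mat_congruence[OF A b c D A' AA' b' bb'] unfolding Meq T_def s_def by blast
  have "(transpose_mat T * (M * T)) $$ (n, n) \<in> squares"
    using congruence_diagonal_in_squares[OF Suc.prems(4) _ T, of n] Suc.prems(1) by simp
  moreover have "(transpose_mat T * (M * T)) $$ (n, n) = s $$ (0, 0)"
    unfolding TMT using A s by simp
  ultimately obtain E E' where E: "E \<in> carrier_mat 1 1" and E': "E' \<in> carrier_mat 1 1"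
    and sE: "s = E * transpose_mat E" and EE': "E * E' = 1\<^sub>m 1" and E'E: "E' * E = 1\<^sub>m 1"
    using unit_square_1x1[OF s r] sr unfolding s_def by metis
  \<comment> \<open>Adding \<open>b\<^sup>T A\<inverse> b\<close> to the Schur complement recovers \<open>D\<close>, since \<open>b + b' = 0\<close>.\<close>
  have "D = D + c * (?A' * (b + b'))" by (simp add: bb' alg cb)
  also have "\<dots> = s + c * (?A' * b)"
    unfolding s_def using b' by (simp add: alg cb mat_dim_add_ac)
  also have "c * (?A' * b) = transpose_mat (L' * b) * (L' * b)"
    by (simp add: cb alg mat_dim_transpose_mult)
  finally have Deq: "D = E * transpose_mat E + transpose_mat (L' * b) * (L' * b)"
    by (simp only: sE)
  let ?F = "four_block_mat L (0\<^sub>m n 1) (transpose_mat (L' * b)) E"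
  have F: "?F \<in> carrier_mat (Suc n) (Suc n)" using four_block_carrier_mat[OF L E] by simp
  note F_props = cholesky_step[OF L L' LL' L'L E E' EE' E'E b b' bb' Deq]
  have "lower_triangular ?F"
    using L E lL by (auto simp: lower_triangular_def)
  moreover have "strongly_invertible ?F"
    using F_props(1) sL strongly_invertible_four_block_mat[OF L E] by simp
  ultimately show ?case
    using F F_props by (intro bexI[of _ ?F]) (simp_all add: Meq AL cb)
qed

theorem corollary3p7:
  fixes M :: "'a :: {comm_semiring_0, comm_monoid_mult} mat" and n :: nat
  assumes squares_add: "\<forall>a \<in> (squares :: 'a set). \<forall>b \<in> (squares :: 'a set). a + b \<in> squares"
    and n: "n \<ge> 1"
    and M: "M \<in> carrier_mat n n"
  shows "(symmetric_matrix M \<and> strongly_invertible M \<and> nonneg_numerical_range M \<longleftrightarrow>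
           (\<exists>L \<in> carrier_mat n n. strongly_invertible L \<and> lower_triangular L \<and> M = L * transpose_mat L))
       \<and> ((\<exists>L \<in> carrier_mat n n. strongly_invertible L \<and> lower_triangular L \<and> M = L * transpose_mat L) \<longleftrightarrow>
           symmetric_matrix M \<and> strongly_invertible M \<and> positive_semidefinite M)"
    (is "(?one \<longleftrightarrow> ?two) \<and> (?two \<longleftrightarrow> ?three)")
proof -
  have "?one \<Longrightarrow> ?two" using cholesky_exists[OF M] by blast
  moreover have "?two \<Longrightarrow> ?three"
  proof -
    assume ?two
    then obtain L where L: "L \<in> carrier_mat n n" "strongly_invertible L" "lower_triangular L"
      and M_eq: "M = L * transpose_mat L" by blast
    have "symmetric_matrix M"
      using L by (simp add: M_eq symmetric_matrix_def mat_dim_transpose_mult)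
    moreover have "strongly_invertible M"
      unfolding M_eq using strongly_invertible_mult_transpose[OF L(1,3,2)] .
    ultimately show ?three
      using L(1) M_eq M by (auto simp: positive_semidefinite_def)
  qed
  moreover have "?three \<Longrightarrow> ?one"
    using nonneg_numerical_range_mult_transpose[OF squares_add]
    by (auto simp: positive_semidefinite_def)
  ultimately show ?thesis by blast
qed

end
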